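(* There is a one-to-one correspondence between isomorphism classes of absolute connectivity lattices and isomorphism classes of chainmails. In the forward direction, it sends (the class of) an absolute connectivity lattice $(L,\mathcal{C})$ to (the class of) the chainmail of absolutely connected elements of $L$; in the backward direction, it sends (the class of) a chainmail $\Gamma$ to (the class of) the lattice $\mathcal{D}(\Gamma)$ of its totally mail-disconnected sets, regarded as an absolute connectivity lattice together with its set of absolutely connected elements.
   Context: Mail: in a poset $P$, a mail is a non-empty subset of $P$ having a common lower bound in $P$. A subset $M$ of $P$ is mail-connected if $M\neq\varnothing$ and for any $x,y\in M$ there is a sequence $s_1,\dots,s_n\in M$ with $s_1=x$, $s_n=y$ and each $\{s_i,s_{i+1}\}$ ($1\le i\le n-1$) a mail in $P$. A chainmail is a poset in which every mail-connected subset has a join. A subset $\mathcal{C}$ of a complete lattice $L$ (with the induced order) is a subchainmail of $L$ if for every subset $M\subseteq\mathcal{C}$ that is mail-connected in the poset $\mathcal{C}$ (so common lower bounds are taken in $\mathcal{C}$), the join of $M$ in $L$ belongs to $\mathcal{C}$. A subset $S$ of a poset $P$ (possibly empty) is totally mail-disconnected in $P$ if no two distinct elements of $S$ have a common lower bound in $P$. For a poset $P$, $\mathcal{D}(P)$ denotes the poset of totally mail-disconnected subsets of $P$, ordered by: $D_1\leqslant D_2$ iff each element of $D_1$ is below some element of $D_2$. A connectivity lattice is a pair $(L,\mathcal{C})$ where $L$ is a complete lattice and $\mathcal{C}\subseteq L$ is a subchainmail of $L$. In this case the map $\mathcal{D}(\mathcal{C})\to L$, $S\mapsto\bigvee S$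 is left Galois adjoint to the map $x\mapsto\mathcal{C}(x)$, where $\mathcal{C}(x)$ is the set of maximal elements of $\{c\in\mathcal{C}\mid c\leqslant x\}$; this is the connectivity adjunction. An absolute connectivity lattice is a connectivity lattice whose connectivity adjunction is an isomorphism of posets. Two connectivity lattices $(L,\mathcal{C})$, $(L',\mathcal{C}')$ are isomorphic if there is an order isomorphism $f\colon L\to L'$ with $f(\mathcal{C})=\mathcal{C}'$; two chainmails are isomorphic if they are isomorphic as posets. Let $0$ be the bottom of $L$ and $L^+=L\setminus\{0\}$ with the induced order. An element $a$ of a complete lattice $L$ is absolutely connected if for every totally mail-disconnected subset $S$ of $L^+$ (including $S=\varnothing$), $a\leqslant\bigvee S$ implies $a\leqslant s$ for some $s\in S$. The set of absolutely connected elements is given the induced order. *)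

theory Defs
  imports "HOL-Algebra.Galois_Connection"
begin

text \<open>
  Posets are \<^typ>\<open>'a gorder\<close> records satisfying \<^const>\<open>partial_order\<close>. A subset \<open>S\<close> of (the
  carrier of) \<open>P\<close> with the induced order is \<open>P\<lparr>carrier := S\<rparr>\<close>; note that \<^const>\<open>Lower\<close>,
  \<^const>\<open>Upper\<close> are relative to the carrier.
\<close>

section \<open>Chainmails\<close>

definition mail :: "'a gorder \<Rightarrow> 'a set \<Rightarrow> bool" where
  "mail P M \<longleftrightarrow> M \<subseteq> carrier P \<and> M \<noteq> {} \<and> Lower P M \<noteq> {}"

definition mail_connected :: "'a gorder \<Rightarrow> 'a set \<Rightarrow> bool" where
  "mail_connected P M \<longleftrightarrow> M \<subseteq> carrier P \<and> M \<noteq> {} \<and>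
     (\<forall>x\<in>M. \<forall>y\<in>M. \<exists>s. s \<noteq> [] \<and> set s \<subseteq> M \<and> hd s = x \<and> last s = y \<and>
        successively (\<lambda>a b. mail P {a, b}) s)"

definition chainmail :: "'a gorder \<Rightarrow> bool" where
  "chainmail P \<longleftrightarrow> partial_order P \<and> (\<forall>M. mail_connected P M \<longrightarrow> (\<exists>j. is_lub P j M))"

definition subchainmail :: "'a gorder \<Rightarrow> 'a set \<Rightarrow> bool" where
  "subchainmail L C \<longleftrightarrow> C \<subseteq> carrier L \<and>
     (\<forall>M. mail_connected (L\<lparr>carrier := C\<rparr>) M \<longrightarrow> \<Squnion>\<^bsub>L\<^esub> M \<in> C)"

section \<open>Totally mail-disconnected sets\<close>

definition totally_mail_disconnected :: "'a gorder \<Rightarrow> 'a set \<Rightarrow> bool" where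
  "totally_mail_disconnected P S \<longleftrightarrow> S \<subseteq> carrier P \<and>
     (\<forall>x\<in>S. \<forall>y\<in>S. x \<noteq> y \<longrightarrow> Lower P {x, y} = {})"

definition disconnected_sets :: "'a gorder \<Rightarrow> 'a set gorder" where
  "disconnected_sets P =
     \<lparr>carrier = {S. totally_mail_disconnected P S}, eq = (=),
      le = (\<lambda>D1 D2. \<forall>x\<in>D1. \<exists>y\<in>D2. x \<sqsubseteq>\<^bsub>P\<^esub> y)\<rparr>"

section \<open>Connectivity lattices\<close>

definition connectivity_lattice :: "'a gorder \<Rightarrow> 'a set \<Rightarrow> bool" where
  "connectivity_lattice L C \<longleftrightarrow> complete_lattice L \<and> subchainmail L C"

definition components :: "'a gorder \<Rightarrow> 'a set \<Rightarrow> 'a \<Rightarrow> 'a set" where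
  "components L C x =
     {c \<in> C. c \<sqsubseteq>\<^bsub>L\<^esub> x \<and> (\<forall>d\<in>C. d \<sqsubseteq>\<^bsub>L\<^esub> x \<longrightarrow> c \<sqsubseteq>\<^bsub>L\<^esub> d \<longrightarrow> d = c)}"

definition connectivity_adjunction :: "'a gorder \<Rightarrow> 'a set \<Rightarrow> ('a set, 'a) galois" where
  "connectivity_adjunction L C =
     \<lparr>orderA = disconnected_sets (L\<lparr>carrier := C\<rparr>), orderB = L,
      lower = (\<lambda>S. \<Squnion>\<^bsub>L\<^esub> S), upper = components L C\<rparr>"

text \<open>
  \<^const>\<open>galois_bijection\<close> states that the two adjoints are monotone and mutually inverse, i.e.
  that the adjunction is an isomorphism of posets.
\<close>

definition absolute_connectivity_lattice :: "'a gorder \<Rightarrow> 'a set \<Rightarrow> bool" where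
  "absolute_connectivity_lattice L C \<longleftrightarrow>
     connectivity_lattice L C \<and> galois_bijection (connectivity_adjunction L C)"

section \<open>Absolutely connected elements\<close>

definition absolutely_connected :: "'a gorder \<Rightarrow> 'a set" where
  "absolutely_connected L = {a \<in> carrier L.
     \<forall>S. totally_mail_disconnected (L\<lparr>carrier := carrier L - {\<bottom>\<^bsub>L\<^esub>}\<rparr>) S \<longrightarrow>
         a \<sqsubseteq>\<^bsub>L\<^esub> \<Squnion>\<^bsub>L\<^esub> S \<longrightarrow> (\<exists>s\<in>S. a \<sqsubseteq>\<^bsub>L\<^esub> s)}"

definition absolutely_connected_poset :: "'a gorder \<Rightarrow> 'a gorder" where
  "absolutely_connected_poset L = L\<lparr>carrier := absolutely_connected L\<rparr>"

section \<open>Isomorphisms\<close>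

definition order_iso :: "'a gorder \<Rightarrow> 'b gorder \<Rightarrow> ('a \<Rightarrow> 'b) \<Rightarrow> bool" where
  "order_iso P Q f \<longleftrightarrow> order_emb P Q f \<and> bij_betw f (carrier P) (carrier Q)"

definition poset_isomorphic :: "'a gorder \<Rightarrow> 'b gorder \<Rightarrow> bool" where
  "poset_isomorphic P Q \<longleftrightarrow> (\<exists>f. order_iso P Q f)"

definition cl_isomorphic :: "'a gorder \<Rightarrow> 'a set \<Rightarrow> 'b gorder \<Rightarrow> 'b set \<Rightarrow> bool" where
  "cl_isomorphic L C L' C' \<longleftrightarrow> (\<exists>f. order_iso L L' f \<and> f ` C = C')"

end

theory Submission
  imports Defs
begin

text \<open>
  If \<open>A\<close> is a subset of a chainmail \<open>P\<close> closed under joins of mail-connected sets, its maximal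
  elements form a totally mail-disconnected set, and every element of \<open>A\<close> lies below one of them.
  Since the set of lower bounds of a family in \<open>\<D>(P)\<close>, viewed inside \<open>P\<close>, is closed in this sense, \<open>\<D>(P)\<close>
  has all infima. Its absolutely connected elements are exactly the singletons \<open>{c}\<close>: every \<open>X\<close> is
  the join of the totally mail-disconnected family of its singletons. For an absolute connectivity
  lattice \<open>(L, \<C>)\<close> the isomorphism \<open>\<D>(\<C>) \<cong> L\<close> preserves absolute connectedness and sends \<open>{c}\<close> to
  \<open>c\<close>, so \<open>\<C>\<close> is the set of absolutely connected elements of \<open>L\<close>; everything else follows by
  transport along isomorphisms.
\<close>

section \<open>Elementwise forms of the definitions\<close>

lemma disconnected_sets_simps [simp]:
  "carrier (disconnected_sets P) = {S. totally_mail_disconnected P S}"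
  "eq (disconnected_sets P) = (=)"
  "S \<sqsubseteq>\<^bsub>disconnected_sets P\<^esub> T \<longleftrightarrow> (\<forall>x\<in>S. \<exists>y\<in>T. x \<sqsubseteq>\<^bsub>P\<^esub> y)"
  by (simp_all add: disconnected_sets_def)

text \<open>Contrapositive form of the definition: a common lower bound \<open>z\<close> forces
  \<open>x = y\<close>. All later uses of disconnectedness take this shape.\<close>

lemma totally_mail_disconnected_iff:
  "totally_mail_disconnected P S \<longleftrightarrow> S \<subseteq> carrier P \<and>
    (\<forall>x\<in>S. \<forall>y\<in>S. \<forall>z\<in>carrier P. z \<sqsubseteq>\<^bsub>P\<^esub> x \<longrightarrow> z \<sqsubseteq>\<^bsub>P\<^esub> y \<longrightarrow> x = y)"
proof -
  have "Lower P {x, y} = {} \<longleftrightarrow> (\<forall>z\<in>carrier P. \<not> (z \<sqsubseteq>\<^bsub>P\<^esub> x \<and> z \<sqsubseteq>\<^bsub>P\<^esub> y))"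
    if "x \<in> carrier P" "y \<in> carrier P" for x y
    using that by (auto simp: Lower_def)
  then show ?thesis
    unfolding totally_mail_disconnected_def by (meson subsetD)
qed

lemma totally_mail_disconnectedI:
  assumes "S \<subseteq> carrier P"
    and "\<And>x y z. \<lbrakk>x \<in> S; y \<in> S; z \<in> carrier P; z \<sqsubseteq>\<^bsub>P\<^esub> x; z \<sqsubseteq>\<^bsub>P\<^esub> y\<rbrakk> \<Longrightarrow> x = y"
  shows "totally_mail_disconnected P S"
  using assms unfolding totally_mail_disconnected_iff by simp

lemma totally_mail_disconnectedD:
  assumes "totally_mail_disconnected P S" "x \<in> S" "y \<in> S" "z \<in> carrier P" "z \<sqsubseteq>\<^bsub>P\<^esub> x" "z \<sqsubseteq>\<^bsub>P\<^esub> y"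
  shows "x = y"
  using assms unfolding totally_mail_disconnected_iff by simp

lemma totally_mail_disconnected_subset:
  "totally_mail_disconnected P S \<Longrightarrow> S \<subseteq> carrier P"
  by (simp add: totally_mail_disconnected_def)

lemma mail_pair_iff:
  "mail P {x, y} \<longleftrightarrow> x \<in> carrier P \<and> y \<in> carrier P \<and> (\<exists>z\<in>carrier P. z \<sqsubseteq>\<^bsub>P\<^esub> x \<and> z \<sqsubseteq>\<^bsub>P\<^esub> y)"
  by (auto simp: mail_def Lower_def)

lemma is_lub_iff:
  assumes "A \<subseteq> carrier L"
  shows "is_lub L u A \<longleftrightarrow> u \<in> carrier L \<and> (\<forall>x\<in>A. x \<sqsubseteq>\<^bsub>L\<^esub> u) \<and>
    (\<forall>v\<in>carrier L. (\<forall>x\<in>A. x \<sqsubseteq>\<^bsub>L\<^esub> v) \<longrightarrow> u \<sqsubseteq>\<^bsub>L\<^esub> v)"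
  using assms unfolding least_def Upper_def by blast

lemma partial_order_subset:
  assumes "partial_order L" "A \<subseteq> carrier L"
  shows "partial_order (L\<lparr>carrier := A\<rparr>)"
proof -
  interpret partial_order L by fact
  interpret S: weak_partial_order "L\<lparr>carrier := A\<rparr>"
    by (rule weak_partial_order_subset) (use assms(2) weak_partial_order_axioms in auto)
  show ?thesis
    by unfold_locales (simp add: eq_is_equal)
qed

lemma (in complete_lattice) is_lub_iff_eq_sup:
  assumes "A \<subseteq> carrier L"
  shows "is_lub L u A \<longleftrightarrow> u = \<Squnion>A"
  using least_unique sup_lub[OF assms] by blast

section \<open>Isomorphisms of posets\<close>

lemma order_iso_inv:
  assumes "order_iso P Q f"
  shows "order_iso Q P (inv_into (carrier P) f)"
proof -
  have b: "bij_betw f (carrier P) (carrier Q)"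
    using assms by (simp add: order_iso_def)
  have "inv_into (carrier P) f x \<in> carrier P" "f (inv_into (carrier P) f x) = x"
    if "x \<in> carrier Q" for x
    using b that by (auto simp: bij_betw_def inv_into_into f_inv_into_f)
  then show ?thesis
    using assms bij_betw_inv_into[OF b] unfolding order_iso_def order_emb_def by metis
qed

lemma order_iso_comp:
  assumes "order_iso P Q f" "order_iso Q R g"
  shows "order_iso P R (g \<circ> f)"
  using assms bij_betw_trans bij_betwE unfolding order_iso_def order_emb_def
  by (metis (no_types, lifting) comp_apply)

lemma poset_isomorphic_sym: "poset_isomorphic P Q \<Longrightarrow> poset_isomorphic Q P"
  unfolding poset_isomorphic_def using order_iso_inv by blast

lemma poset_isomorphic_trans:
  "poset_isomorphic P Q \<Longrightarrow> poset_isomorphic Q R \<Longrightarrow> poset_isomorphic P R"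
  unfolding poset_isomorphic_def using order_iso_comp by blast

lemma cl_isomorphic_sym:
  assumes "cl_isomorphic L C L' C'" "C \<subseteq> carrier L"
  shows "cl_isomorphic L' C' L C"
proof -
  obtain f where f: "order_iso L L' f" "f ` C = C'"
    using assms by (auto simp: cl_isomorphic_def)
  then have "inj_on f (carrier L)"
    by (simp add: order_iso_def bij_betw_def)
  then have "inv_into (carrier L) f ` C' = C"
    using f(2) assms(2) by (metis inv_into_image_cancel)
  then show ?thesis
    using order_iso_inv[OF f(1)] by (auto simp: cl_isomorphic_def)
qed

lemma cl_isomorphic_trans:
  assumes "cl_isomorphic L C L' C'" "cl_isomorphic L' C' L'' C''"
  shows "cl_isomorphic L C L'' C''"
  using assms unfolding cl_isomorphic_def using order_iso_comp by (metis image_comp)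

lemma order_iso_restrict:
  assumes "order_iso L L' f" "A \<subseteq> carrier L"
  shows "order_iso (L\<lparr>carrier := A\<rparr>) (L'\<lparr>carrier := f ` A\<rparr>) f"
proof -
  have "weak_partial_order L" "weak_partial_order L'" and b: "bij_betw f (carrier L) (carrier L')"
    using assms(1) by (auto simp: order_iso_def order_emb_def)
  moreover have "bij_betw f A (f ` A)" "f ` A \<subseteq> carrier L'"
    using b assms(2) unfolding bij_betw_def by (auto intro: inj_on_subset)
  ultimately have "weak_partial_order (L\<lparr>carrier := A\<rparr>)" "weak_partial_order (L'\<lparr>carrier := f ` A\<rparr>)"
    "bij_betw f A (f ` A)"
    using assms(2) by (simp_all add: weak_partial_order_subset)
  then show ?thesis
    using assms unfolding order_iso_def order_emb_def by (simp add: subset_iff)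
qed

lemma cl_isomorphic_imp_poset_isomorphic:
  assumes "cl_isomorphic L C L' C'" "C \<subseteq> carrier L"
  shows "poset_isomorphic (L\<lparr>carrier := C\<rparr>) (L'\<lparr>carrier := C'\<rparr>)"
  using assms order_iso_restrict unfolding cl_isomorphic_def poset_isomorphic_def by blast

lemma totally_mail_disconnected_image:
  assumes "order_iso P Q f" "totally_mail_disconnected P S"
  shows "totally_mail_disconnected Q (f ` S)"
proof (rule totally_mail_disconnectedI)
  have b: "bij_betw f (carrier P) (carrier Q)" and S: "S \<subseteq> carrier P"
    using assms by (auto simp: order_iso_def totally_mail_disconnected_def)
  then show "f ` S \<subseteq> carrier Q"
    by (auto simp: bij_betw_def)
  fix x y z
  assume "x \<in> f ` S" "y \<in> f ` S" "z \<in> carrier Q" and le: "z \<sqsubseteq>\<^bsub>Q\<^esub> x" "z \<sqsubseteq>\<^bsub>Q\<^esub> y"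
  then obtain x' y' z' where *: "x' \<in> S" "y' \<in> S" "z' \<in> carrier P" "x = f x'" "y = f y'" "z = f z'"
    using b unfolding bij_betw_def by (metis imageE)
  then have "z' \<sqsubseteq>\<^bsub>P\<^esub> x'" "z' \<sqsubseteq>\<^bsub>P\<^esub> y'"
    using assms(1) S le by (auto simp: order_iso_def order_emb_def)
  then show "x = y"
    using totally_mail_disconnectedD[OF assms(2)] * by blast
qed

text \<open>Antisymmetry is where disconnectedness enters. If \<open>x\<close> in \<open>S\<close>
  lies below \<open>y\<close> in \<open>T\<close> and \<open>y\<close> below \<open>z\<close> in
  \<open>S\<close>, then \<open>x\<close> itself is a common lower bound of \<open>x\<close> and
  \<open>z\<close>, so \<open>x = z\<close>, and \<open>y\<close> is squeezed between them.\<close>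

lemma partial_order_disconnected_sets:
  fixes P (structure)
  assumes "partial_order P"
  shows "partial_order (disconnected_sets P)"
proof -
  interpret partial_order P by fact
  have sub: "S \<subseteq> T" if TS: "totally_mail_disconnected P S" "totally_mail_disconnected P T"
    and le: "\<forall>x\<in>S. \<exists>y\<in>T. x \<sqsubseteq> y" "\<forall>x\<in>T. \<exists>y\<in>S. x \<sqsubseteq> y" for S T
  proof
    fix x assume x: "x \<in> S"
    then obtain y z where yz: "y \<in> T" "x \<sqsubseteq> y" "z \<in> S" "y \<sqsubseteq> z"
      using le by meson
    have c: "x \<in> carrier P" "y \<in> carrier P" "z \<in> carrier P"
      using TS x yz totally_mail_disconnected_subset by blast+
    then have "x \<sqsubseteq> z"
      using yz le_trans by blast
    then have "x = z"
      using totally_mail_disconnectedD[OF TS(1) x yz(3) c(1)] c by blast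
    then show "x \<in> T"
      using yz c le_antisym by blast
  qed
  show ?thesis
  proof
    fix S assume "S \<in> carrier (disconnected_sets P)"
    then show "S \<sqsubseteq>\<^bsub>disconnected_sets P\<^esub> S"
      using totally_mail_disconnected_subset le_refl by fastforce
  next
    fix S T
    assume "S \<sqsubseteq>\<^bsub>disconnected_sets P\<^esub> T" "T \<sqsubseteq>\<^bsub>disconnected_sets P\<^esub> S"
      "S \<in> carrier (disconnected_sets P)" "T \<in> carrier (disconnected_sets P)"
    then show "S .=\<^bsub>disconnected_sets P\<^esub> T"
      using sub[of S T] sub[of T S] by simp
  next
    fix S T U
    assume *: "S \<sqsubseteq>\<^bsub>disconnected_sets P\<^esub> T" "T \<sqsubseteq>\<^bsub>disconnected_sets P\<^esub> U"
      "S \<in> carrier (disconnected_sets P)" "T \<in> carrier (disconnected_sets P)"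
      "U \<in> carrier (disconnected_sets P)"
    show "S \<sqsubseteq>\<^bsub>disconnected_sets P\<^esub> U"
      unfolding disconnected_sets_simps
    proof
      fix x assume x: "x \<in> S"
      then obtain y where y: "y \<in> T" "x \<sqsubseteq> y"
        using * by auto
      then obtain z where z: "z \<in> U" "y \<sqsubseteq> z"
        using * by auto
      have "x \<in> carrier P" "y \<in> carrier P" "z \<in> carrier P"
        using * x y z by (auto dest: totally_mail_disconnected_subset)
      then show "\<exists>z\<in>U. x \<sqsubseteq> z"
        using y z le_trans by blast
    qed
  qed auto
qed

lemma order_iso_disconnected_sets:
  assumes "order_iso P Q f" "partial_order P" "partial_order Q"
  shows "order_iso (disconnected_sets P) (disconnected_sets Q) ((`) f)"
proof -
  have b: "bij_betw f (carrier P) (carrier Q)"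
    using assms(1) by (simp add: order_iso_def)
  let ?g = "inv_into (carrier P) f"
  have "bij_betw ((`) f) (carrier (disconnected_sets P)) (carrier (disconnected_sets Q))"
  proof (rule bij_betw_byWitness[where f' = "(`) ?g"])
    show "\<forall>S\<in>carrier (disconnected_sets P). ?g ` f ` S = S"
      using b by (auto simp: bij_betw_def inv_into_image_cancel totally_mail_disconnected_subset)
    show "\<forall>S\<in>carrier (disconnected_sets Q). f ` ?g ` S = S"
      using b by (auto simp: bij_betw_def image_inv_into_cancel totally_mail_disconnected_subset)
    show "(`) f ` carrier (disconnected_sets P) \<subseteq> carrier (disconnected_sets Q)"
      using totally_mail_disconnected_image[OF assms(1)] by auto
    show "(`) ?g ` carrier (disconnected_sets Q) \<subseteq> carrier (disconnected_sets P)"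
      using totally_mail_disconnected_image[OF order_iso_inv[OF assms(1)]] by auto
  qed
  moreover have "f x \<sqsubseteq>\<^bsub>Q\<^esub> f y \<longleftrightarrow> x \<sqsubseteq>\<^bsub>P\<^esub> y"
    if "x \<in> carrier P" "y \<in> carrier P" for x y
    using assms(1) that by (auto simp: order_iso_def order_emb_def)
  then have "(f ` S \<sqsubseteq>\<^bsub>disconnected_sets Q\<^esub> f ` T) \<longleftrightarrow> (S \<sqsubseteq>\<^bsub>disconnected_sets P\<^esub> T)"
    if "S \<subseteq> carrier P" "T \<subseteq> carrier P" for S T
    using that unfolding disconnected_sets_simps by (simp add: subset_iff)
  ultimately show ?thesis
    unfolding order_iso_def order_emb_def
    using partial_order_disconnected_sets assms(2,3) totally_mail_disconnected_subset
    by (metis disconnected_sets_simps(1) mem_Collect_eq partial_order.axioms(1))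
qed

section \<open>Isomorphisms preserve joins and absolute connectedness\<close>

lemma order_iso_is_lub:
  assumes "order_iso L L' f" "A \<subseteq> carrier L" "is_lub L u A"
  shows "is_lub L' (f u) (f ` A)"
proof -
  have b: "f ` carrier L = carrier L'" and
    e: "\<And>x y. x \<in> carrier L \<Longrightarrow> y \<in> carrier L \<Longrightarrow> f x \<sqsubseteq>\<^bsub>L'\<^esub> f y \<longleftrightarrow> x \<sqsubseteq>\<^bsub>L\<^esub> y"
    using assms(1) by (auto simp: order_iso_def order_emb_def bij_betw_def)
  have "f ` A \<subseteq> carrier L'"
    using assms(2) b by blast
  moreover have "A \<subseteq> carrier L \<Longrightarrow> u \<in> carrier L" using assms(3) by blast
  ultimately show ?thesis
    using assms(2,3) unfolding is_lub_iff[OF assms(2)] is_lub_iff[OF \<open>f ` A \<subseteq> carrier L'\<close>] b[symmetric]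
    by (simp add: e subset_iff)
qed

text \<open>The bottom is the join of the empty set, so it is preserved like any other join.\<close>

lemma order_iso_bottom:
  assumes "order_iso L L' f" "complete_lattice L" "complete_lattice L'"
  shows "f \<bottom>\<^bsub>L\<^esub> = \<bottom>\<^bsub>L'\<^esub>"
proof -
  interpret L: complete_lattice L by fact
  interpret L': complete_lattice L' by fact
  show ?thesis
  proof (rule L'.least_unique)
    show "is_lub L' (f \<bottom>\<^bsub>L\<^esub>) {}"
      using order_iso_is_lub[OF assms(1), of "{}"] L.bottom_least by simp
    show "is_lub L' \<bottom>\<^bsub>L'\<^esub> {}"
      using L'.bottom_least by simp
  qed
qed

text \<open>A test family in \<open>L'\<close> is pulled back along the inverse isomorphism, the
  defining property of \<open>a\<close> is applied in \<open>L\<close>, and the member found there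
  is pushed forward again.\<close>

lemma order_iso_absolutely_connected_subset:
  assumes f: "order_iso L L' f" and L: "complete_lattice L" and L': "complete_lattice L'"
  shows "f ` absolutely_connected L \<subseteq> absolutely_connected L'"
proof
  interpret L: complete_lattice L by fact
  interpret L': complete_lattice L' by fact
  let ?g = "inv_into (carrier L) f"
  let ?L = "L\<lparr>carrier := carrier L - {\<bottom>\<^bsub>L\<^esub>}\<rparr>" and ?L' = "L'\<lparr>carrier := carrier L' - {\<bottom>\<^bsub>L'\<^esub>}\<rparr>"
  note g = order_iso_inv[OF f]
  have b: "f ` carrier L = carrier L'" and
    e: "\<And>x y. x \<in> carrier L \<Longrightarrow> y \<in> carrier L \<Longrightarrow> f x \<sqsubseteq>\<^bsub>L'\<^esub> f y \<longleftrightarrow> x \<sqsubseteq>\<^bsub>L\<^esub> y"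
    using f by (auto simp: order_iso_def order_emb_def bij_betw_def)
  have gc: "?g y \<in> carrier L" and fg: "f (?g y) = y" if "y \<in> carrier L'" for y
    using that b by (metis inv_into_into, metis f_inv_into_f)
  \<comment> \<open>Since \<open>?g\<close> preserves the bottom, it restricts to the non-bottom
    elements, which form the poset where the test families live.\<close>
  have g0: "?g ` (carrier L' - {\<bottom>\<^bsub>L'\<^esub>}) = carrier L - {\<bottom>\<^bsub>L\<^esub>}"
  proof -
    have "bij_betw ?g (carrier L') (carrier L)"
      using g by (simp add: order_iso_def)
    then show ?thesis
      using order_iso_bottom[OF g L' L] inj_on_image_set_diff[of ?g "carrier L'" "carrier L'" "{\<bottom>\<^bsub>L'\<^esub>}"]
      by (simp add: bij_betw_def)
  qed
  have iso: "order_iso ?L' ?L ?g"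
    using order_iso_restrict[OF g, of "carrier L' - {\<bottom>\<^bsub>L'\<^esub>}"] g0 by simp
  fix b' assume "b' \<in> f ` absolutely_connected L"
  then obtain a where a: "a \<in> absolutely_connected L" "b' = f a" by blast
  have ac: "a \<in> carrier L" using a(1) by (simp add: absolutely_connected_def)
  show "b' \<in> absolutely_connected L'"
    unfolding absolutely_connected_def
  proof (intro CollectI conjI allI impI)
    show "b' \<in> carrier L'" using a(2) ac b by blast
    fix S assume S: "totally_mail_disconnected ?L' S" and le: "b' \<sqsubseteq>\<^bsub>L'\<^esub> \<Squnion>\<^bsub>L'\<^esub>S"
    have Sc: "S \<subseteq> carrier L'" using totally_mail_disconnected_subset[OF S] by auto
    have gS: "?g ` S \<subseteq> carrier L" using Sc gc by blast
    have "is_lub L (?g (\<Squnion>\<^bsub>L'\<^esub>S)) (?g ` S)"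
      using order_iso_is_lub[OF g Sc] L'.sup_lub[OF Sc] by blast
    then have eq: "?g (\<Squnion>\<^bsub>L'\<^esub>S) = \<Squnion>\<^bsub>L\<^esub>(?g ` S)"
      using L.is_lub_iff_eq_sup[OF gS] by blast
    have sc: "\<Squnion>\<^bsub>L'\<^esub>S \<in> carrier L'" using Sc by simp
    have "a \<sqsubseteq>\<^bsub>L\<^esub> \<Squnion>\<^bsub>L\<^esub>(?g ` S)"
      using le e[OF ac gc[OF sc]] fg[OF sc] a(2) eq by simp
    moreover have "totally_mail_disconnected ?L (?g ` S)"
      by (rule totally_mail_disconnected_image[OF iso S])
    ultimately obtain s where "s \<in> S" "a \<sqsubseteq>\<^bsub>L\<^esub> ?g s"
      using a(1) unfolding absolutely_connected_def by blast
    then show "\<exists>s\<in>S. b' \<sqsubseteq>\<^bsub>L'\<^esub> s"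
      using e[OF ac gc] fg Sc a(2) by (metis subset_iff)
  qed
qed

lemma absolutely_connected_subset_carrier: "absolutely_connected L \<subseteq> carrier L"
  by (auto simp: absolutely_connected_def)

text \<open>The second inclusion is the first one applied to the inverse isomorphism.\<close>

lemma order_iso_absolutely_connected:
  assumes f: "order_iso L L' f" and L: "complete_lattice L" and L': "complete_lattice L'"
  shows "f ` absolutely_connected L = absolutely_connected L'"
proof
  show "f ` absolutely_connected L \<subseteq> absolutely_connected L'"
    by (rule order_iso_absolutely_connected_subset) fact+
  have b: "f ` carrier L = carrier L'"
    using f by (simp add: order_iso_def bij_betw_def)
  show "absolutely_connected L' \<subseteq> f ` absolutely_connected L"
  proof
    fix y assume y: "y \<in> absolutely_connected L'"
    then have "f (inv_into (carrier L) f y) = y"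
      using absolutely_connected_subset_carrier b by (metis f_inv_into_f subsetD)
    then show "y \<in> f ` absolutely_connected L"
      using order_iso_absolutely_connected_subset[OF order_iso_inv[OF f] L' L] y
      by (metis image_eqI image_subset_iff)
  qed
qed

section \<open>Mail-connected sets\<close>

lemma mail_connected_subset: "mail_connected P M \<Longrightarrow> M \<subseteq> carrier P"
  by (simp add: mail_connected_def)

lemma mail_connectedE:
  assumes "mail_connected P M" "x \<in> M" "y \<in> M"
  obtains s where "s \<noteq> []" "set s \<subseteq> M" "hd s = x" "last s = y"
    "successively (\<lambda>a b. mail P {a, b}) s"
proof -
  have "\<exists>s. s \<noteq> [] \<and> set s \<subseteq> M \<and> hd s = x \<and> last s = y \<and> successively (\<lambda>a b. mail P {a, b}) s"
    using assms by (simp add: mail_connected_def)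
  then show thesis
    using that by (elim exE conjE)
qed

lemma mail_connected_pair:
  assumes "mail P {a, b}"
  shows "mail_connected P {a, b}"
proof -
  have "\<exists>s. s \<noteq> [] \<and> set s \<subseteq> {a, b} \<and> hd s = x \<and> last s = y \<and> successively (\<lambda>a b. mail P {a, b}) s"
    if "x \<in> {a, b}" "y \<in> {a, b}" for x y
    \<comment> \<open>The two-entry list also serves when \<open>x = y\<close>: the common lower
      bound of \<open>a\<close> and \<open>b\<close> makes \<open>{x, x}\<close> a mail.\<close>
    using that assms by (intro exI[of _ "[x, y]"]) (auto simp: mail_pair_iff)
  moreover have "{a, b} \<subseteq> carrier P"
    using assms by (simp add: mail_def)
  ultimately show ?thesis
    unfolding mail_connected_def by blast
qed

locale poset = partial_order P for P :: "'a gorder" (structure)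

lemma (in poset) mail_connected_Un:
  assumes "mail_connected P M" "mail_connected P N" "a \<in> M" "a \<in> N"
  shows "mail_connected P (M \<union> N)"
proof -
  let ?path = "\<lambda>A x y s. s \<noteq> [] \<and> set s \<subseteq> A \<and> hd s = x \<and> last s = y \<and>
    successively (\<lambda>a b. mail P {a, b}) s"
  have "a \<in> carrier P"
    using mail_connected_subset[OF assms(1)] assms(3) by blast
  \<comment> \<open>In the concatenation \<open>s @ t\<close> below, \<open>a\<close> occurs twice
    in a row at the junction, so \<open>{a, a}\<close> has to be a mail.\<close>
  then have aa: "mail P {a, a}"
    unfolding mail_pair_iff using le_refl by blast
  have "\<exists>s. ?path (M \<union> N) x y s" if "x \<in> M \<union> N" "y \<in> M \<union> N" for x y
  proof -
    have "\<exists>s. ?path M x a s \<or> ?path N x a s"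
      using that(1) assms by (cases "x \<in> M") (simp_all add: mail_connected_def, blast+)
    then obtain s where s: "?path M x a s \<or> ?path N x a s" ..
    have "\<exists>t. ?path M a y t \<or> ?path N a y t"
      using that(2) assms by (cases "y \<in> M") (simp_all add: mail_connected_def, blast+)
    then obtain t where t: "?path M a y t \<or> ?path N a y t" ..
    have "?path (M \<union> N) x y (s @ t)"
      using s t aa by (auto simp: successively_append_iff)
    then show ?thesis by blast
  qed
  moreover have "M \<union> N \<subseteq> carrier P" "M \<union> N \<noteq> {}"
    using assms mail_connected_subset by auto
  ultimately show ?thesis
    unfolding mail_connected_def by blast
qed

text \<open>Two points of the union lie in two members that share \<open>a\<close>, so a path can be
  found inside the union of just these two.\<close>

lemma (in poset) mail_connected_Union:
  assumes "\<And>M. M \<in> F \<Longrightarrow> mail_connected P M \<and> a \<in> M" "F \<noteq> {}"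
  shows "mail_connected P (\<Union>F)"
  unfolding mail_connected_def
proof (intro conjI ballI)
  show "\<Union>F \<subseteq> carrier P" "\<Union>F \<noteq> {}"
    using assms mail_connected_subset by blast+
  fix x y assume "x \<in> \<Union>F" "y \<in> \<Union>F"
  then obtain M N where MN: "M \<in> F" "N \<in> F" "x \<in> M" "y \<in> N" by blast
  then have "mail_connected P (M \<union> N)"
    using assms mail_connected_Un by blast
  then obtain s where "s \<noteq> []" "set s \<subseteq> M \<union> N" "hd s = x" "last s = y"
    "successively (\<lambda>a b. mail P {a, b}) s"
    using mail_connectedE[of P "M \<union> N" x y] MN by blast
  then show "\<exists>s. s \<noteq> [] \<and> set s \<subseteq> \<Union>F \<and> hd s = x \<and> last s = y \<and>
      successively (\<lambda>a b. mail P {a, b}) s"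
    using MN by blast
qed

text \<open>The element of \<open>S\<close> above a point of \<open>M\<close> stays the same along a
  mail: if \<open>x\<close> is below \<open>s\<close>, \<open>y\<close> is below \<open>t\<close>
  and \<open>{x, y}\<close> is a mail, the common lower bound lies below both \<open>s\<close> and
  \<open>t\<close>, so \<open>s = t\<close>. Induction along a path carries one \<open>s\<close> to
  all of \<open>M\<close>. This is the link between connected and disconnected sets used for infima
  and joins in \<open>D\<close>.\<close>

lemma (in poset) mail_connected_below_unique:
  assumes S: "totally_mail_disconnected P S" and M: "mail_connected P M"
    and below: "\<forall>x\<in>M. \<exists>s\<in>S. x \<sqsubseteq> s"
  obtains s where "s \<in> S" "\<forall>x\<in>M. x \<sqsubseteq> s"
proof -
  note Sc = totally_mail_disconnected_subset[OF S] and Mc = mail_connected_subset[OF M]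
  have step: "y \<sqsubseteq> s" if "s \<in> S" "x \<in> M" "y \<in> M" "x \<sqsubseteq> s" "mail P {x, y}" for x y s
  proof -
    obtain z where z: "z \<in> carrier P" "z \<sqsubseteq> x" "z \<sqsubseteq> y"
      using \<open>mail P {x, y}\<close> unfolding mail_pair_iff by blast
    obtain t where t: "t \<in> S" "y \<sqsubseteq> t"
      using below \<open>y \<in> M\<close> by blast
    have "s \<in> carrier P" "t \<in> carrier P" "x \<in> carrier P" "y \<in> carrier P"
      using that t Sc Mc by auto
    then have "z \<sqsubseteq> s" "z \<sqsubseteq> t"
      using le_trans[OF z(2) \<open>x \<sqsubseteq> s\<close>] le_trans[OF z(3) t(2)] z(1) by simp_all
    then show ?thesis
      using totally_mail_disconnectedD[OF S \<open>s \<in> S\<close> t(1) z(1)] t by simp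
  qed
  have path: "last p \<sqsubseteq> s"
    if "successively (\<lambda>a b. mail P {a, b}) p" "p \<noteq> []" "set p \<subseteq> M" "hd p \<sqsubseteq> s" "s \<in> S" for p s
    using that
  proof (induction p rule: induct_list012)
    case (3 x y p)
    then have "y \<sqsubseteq> s" using step[of s x y] by simp
    with 3 show ?case by simp
  qed simp_all
  obtain x where x: "x \<in> M"
    using M by (auto simp: mail_connected_def)
  then obtain s where s: "s \<in> S" "x \<sqsubseteq> s"
    using below by auto
  have "y \<sqsubseteq> s" if "y \<in> M" for y
  proof -
    obtain p where "p \<noteq> []" "set p \<subseteq> M" "hd p = x" "last p = y" "successively (\<lambda>a b. mail P {a, b}) p"
      using mail_connectedE[OF M x \<open>y \<in> M\<close>] .
    then show ?thesis
      using path[of p s] s by simp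
  qed
  then show thesis
    using that s by blast
qed

section \<open>The lattice of totally mail-disconnected sets\<close>

text \<open>A locale form of \<open>chainmail\<close>, so that the lattice structure of
  \<open>D\<close> is established once as a \<open>sublocale\<close> and is then available for every
  interpreted chainmail.\<close>

locale chainmail_order = poset +
  assumes mail_connected_lub: "mail_connected P M \<Longrightarrow> \<exists>j. is_lub P j M"

lemma chainmail_iff: "chainmail P \<longleftrightarrow> chainmail_order P"
  by (simp add: chainmail_def chainmail_order_def chainmail_order_axioms_def poset_def)

context chainmail_order
begin

abbreviation D where "D \<equiv> disconnected_sets P"

sublocale D: partial_order D
  by (rule partial_order_disconnected_sets) (rule partial_order_axioms)

section \<open>Maximal elements of sets closed under joins of mail-connected subsets\<close>

definition maximal_elements :: "'a set \<Rightarrow> 'a set" where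
  "maximal_elements A = {m \<in> A. \<forall>d\<in>A. m \<sqsubseteq> d \<longrightarrow> d = m}"

text \<open>Two maximal elements with a common lower bound form a mail-connected pair. Its join
  belongs to \<open>A\<close> and lies above both, so by maximality it equals both.\<close>

lemma maximal_elements_disconnected:
  assumes A: "A \<subseteq> carrier P"
    and lub: "\<And>M j. \<lbrakk>M \<subseteq> A; mail_connected P M; is_lub P j M\<rbrakk> \<Longrightarrow> j \<in> A"
  shows "totally_mail_disconnected P (maximal_elements A)"
proof (rule totally_mail_disconnectedI)
  show "maximal_elements A \<subseteq> carrier P"
    using A by (auto simp: maximal_elements_def)
  fix x y z
  assume x: "x \<in> maximal_elements A" and y: "y \<in> maximal_elements A"
    and z: "z \<in> carrier P" "z \<sqsubseteq> x" "z \<sqsubseteq> y"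
  have xy: "{x, y} \<subseteq> A"
    using x y by (auto simp: maximal_elements_def)
  then have m: "mail_connected P {x, y}"
    using A z by (intro mail_connected_pair) (auto simp: mail_pair_iff)
  then obtain j where j: "is_lub P j {x, y}"
    using mail_connected_lub by blast
  then have "j \<in> A"
    using lub xy m by blast
  moreover have "x \<sqsubseteq> j" "y \<sqsubseteq> j"
    using least_Upper_above[OF j] mail_connected_subset[OF m] by simp_all
  ultimately have "j = x" "j = y"
    using x y by (auto simp: maximal_elements_def)
  then show "x = y" by simp
qed

text \<open>The maximal element above \<open>a\<close> is the join of the mail-connected component of \<open>a\<close> in \<open>A\<close>.\<close>

lemma below_maximal_element:
  assumes A: "A \<subseteq> carrier P"
    and lub: "\<And>M j. \<lbrakk>M \<subseteq> A; mail_connected P M; is_lub P j M\<rbrakk> \<Longrightarrow> j \<in> A"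
    and a: "a \<in> A"
  shows "\<exists>m\<in>maximal_elements A. a \<sqsubseteq> m"
proof -
  define F where "F = {M. M \<subseteq> A \<and> mail_connected P M \<and> a \<in> M}"
  have ac: "a \<in> carrier P" using a A by blast
  have pair: "{a, b} \<in> F" if "b \<in> A" "a \<sqsubseteq> b" for b
  proof -
    have "mail P {a, b}"
      using that ac A by (auto simp: mail_pair_iff)
    then show ?thesis
      using that a mail_connected_pair by (auto simp: F_def)
  qed
  have aF: "{a, a} \<in> F"
    using pair[OF a] ac by simp
  have conn: "mail_connected P (\<Union>F)"
    by (rule mail_connected_Union[where a = a]) (use aF in \<open>auto simp: F_def\<close>)
  then obtain j where j: "is_lub P j (\<Union>F)"
    using mail_connected_lub by blast
  have FA: "\<Union>F \<subseteq> A" by (auto simp: F_def)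
  then have jA: "j \<in> A"
    using lub conn j by blast
  have up: "x \<sqsubseteq> j" if "x \<in> \<Union>F" for x
    using j that FA A least_Upper_above[OF j that] by blast
  have aj: "a \<sqsubseteq> j"
    using up aF by blast
  \<comment> \<open>An element \<open>d\<close> of \<open>A\<close> above \<open>j\<close> is also
    above \<open>a\<close>, so \<open>{a, d}\<close> is mail-connected. Hence \<open>d\<close>
    already belongs to the component and lies below its join \<open>j\<close>.\<close>
  have "d = j" if "d \<in> A" "j \<sqsubseteq> d" for d
  proof -
    have c: "d \<in> carrier P" "j \<in> carrier P" using that jA A by auto
    then have "a \<sqsubseteq> d"
      using le_trans[OF aj that(2) ac] by blast
    then have "d \<sqsubseteq> j"
      using pair[OF that(1)] up by blast
    then show ?thesis
      using that c le_antisym by blast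
  qed
  then have "j \<in> maximal_elements A"
    using jA by (auto simp: maximal_elements_def)
  then show ?thesis
    using aj by blast
qed

text \<open>A lower bound of \<open>F\<close> in \<open>D\<close> is contained in the set
  \<open>A\<close> of all elements that lie below some element of every member of \<open>F\<close>.
  As \<open>A\<close> is closed under connected joins, each of its elements is below a maximal one,
  which makes the maximal elements the greatest lower bound.\<close>

lemma D_is_glb:
  assumes F: "F \<subseteq> carrier D"
  shows "\<exists>K. is_glb D K F"
proof -
  define A where "A = {x \<in> carrier P. \<forall>S\<in>F. \<exists>s\<in>S. x \<sqsubseteq> s}"
  have A: "A \<subseteq> carrier P" by (auto simp: A_def)
  have lub: "j \<in> A" if M: "M \<subseteq> A" "mail_connected P M" "is_lub P j M" for M j
  proof -
    have lub: "j \<in> carrier P" "\<And>v. v \<in> carrier P \<Longrightarrow> \<forall>x\<in>M. x \<sqsubseteq> v \<Longrightarrow> j \<sqsubseteq> v"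
      using M(3) is_lub_iff[OF mail_connected_subset[OF M(2)], of j] by auto
    have "\<exists>s\<in>S. j \<sqsubseteq> s" if "S \<in> F" for S
    proof -
      have S: "totally_mail_disconnected P S"
        using F that by auto
      have below: "\<forall>x\<in>M. \<exists>s\<in>S. x \<sqsubseteq> s"
        using M(1) that by (auto simp: A_def)
      \<comment> \<open>One element \<open>s\<close> of \<open>S\<close> dominates the whole of
        \<open>M\<close>, hence also its join \<open>j\<close>.\<close>
      obtain s where s: "s \<in> S" "\<forall>x\<in>M. x \<sqsubseteq> s"
        using mail_connected_below_unique[OF S M(2) below] .
      then show ?thesis
        using lub(2)[of s] subsetD[OF totally_mail_disconnected_subset[OF S] s(1)] by auto
    qed
    then show ?thesis
      using lub(1) by (simp add: A_def)
  qed
  have "is_glb D (maximal_elements A) F"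
  proof (rule greatest_LowerI)
    show "maximal_elements A \<sqsubseteq>\<^bsub>D\<^esub> S" if "S \<in> F" for S
      using that by (auto simp: maximal_elements_def A_def)
    show "T \<sqsubseteq>\<^bsub>D\<^esub> maximal_elements A" if T: "T \<in> Lower D F" for T
    proof -
      have "T \<subseteq> A"
        using T F totally_mail_disconnected_subset[of P T] unfolding Lower_def A_def by fastforce
      then show ?thesis
        using below_maximal_element[OF A lub] by (auto simp: subset_iff)
    qed
    show "maximal_elements A \<in> carrier D"
      using maximal_elements_disconnected[OF A lub] by simp
  qed (rule F)
  then show ?thesis by blast
qed

sublocale D: complete_lattice D
proof (rule D.complete_lattice_criterion1)
  \<comment> \<open>The top element is the infimum of the empty family.\<close>
  show "\<exists>g. greatest D g (carrier D)"
    using D_is_glb[of "{}"] by (simp only: Lower_empty empty_subsetI simp_thms)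
qed (rule D_is_glb)

text \<open>The non-bottom elements of \<open>D\<close> are therefore the nonempty disconnected
  sets; in this form they enter the test for absolute connectedness.\<close>

lemma D_bottom: "\<bottom>\<^bsub>D\<^esub> = {}"
  by (rule D.least_unique[OF D.bottom_least]) (simp add: least_def totally_mail_disconnected_def)

text \<open>The order of \<open>D\<close> tests the elements of its left-hand set one at a time, so
  a union is below every upper bound of the family. The hypothesis places the union in the carrier,
  and its members too, since subsets of a disconnected set are disconnected.\<close>

lemma D_sup_eq_Union:
  assumes "totally_mail_disconnected P (\<Union>F)"
  shows "\<Squnion>\<^bsub>D\<^esub>F = \<Union>F"
proof -
  have F: "F \<subseteq> carrier D"
    using assms by (auto simp: totally_mail_disconnected_iff)
  have "is_lub D (\<Union>F) F"
    unfolding is_lub_iff[OF F]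
  proof (intro conjI ballI impI)
    show "\<Union>F \<in> carrier D"
      using assms by simp
    show "S \<sqsubseteq>\<^bsub>D\<^esub> \<Union>F" if "S \<in> F" for S
      unfolding disconnected_sets_simps
    proof
      fix x assume "x \<in> S"
      then have x: "x \<in> \<Union>F"
        using that by (rule UnionI[rotated])
      then have "x \<sqsubseteq> x"
        using subsetD[OF totally_mail_disconnected_subset[OF assms]] by (intro le_refl)
      then show "\<exists>y\<in>\<Union>F. x \<sqsubseteq> y"
        using x by (rule bexI)
    qed
    show "\<Union>F \<sqsubseteq>\<^bsub>D\<^esub> T" if "\<forall>S\<in>F. S \<sqsubseteq>\<^bsub>D\<^esub> T" for T
      using that by simp
  qed
  then show ?thesis
    using D.is_lub_iff_eq_sup[OF F] by simp
qed

section \<open>Absolutely connected elements of the lattice of disconnected sets\<close>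

lemma singleton_in_D: "c \<in> carrier P \<Longrightarrow> totally_mail_disconnected P {c}"
  by (simp add: totally_mail_disconnected_def)

text \<open>In one direction \<open>X\<close> is tested on the family of its own singletons: a
  nonempty set below \<open>{y}\<close> and \<open>{z}\<close> would contain a common lower bound of
  \<open>y\<close> and \<open>z\<close>. In the other direction, a disconnected family of nonempty
  sets has a disconnected union, so its join is that union, and an element above \<open>c\<close> in
  it already lies in one member.\<close>

lemma absolutely_connected_D: "absolutely_connected D = (\<lambda>c. {c}) ` carrier P"
proof (intro equalityI subsetI)
  fix X assume X: "X \<in> absolutely_connected D"
  have XD: "totally_mail_disconnected P X"
    using X by (simp add: absolutely_connected_def)
  note Xc = totally_mail_disconnected_subset[OF XD]
  let ?F = "(\<lambda>c. {c}) ` X"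
  have U: "\<Union>?F = X" by auto
  have "totally_mail_disconnected (D\<lparr>carrier := carrier D - {\<bottom>\<^bsub>D\<^esub>}\<rparr>) ?F"
  proof (rule totally_mail_disconnectedI)
    show "?F \<subseteq> carrier (D\<lparr>carrier := carrier D - {\<bottom>\<^bsub>D\<^esub>}\<rparr>)"
      using Xc by (auto simp: D_bottom singleton_in_D)
    fix Y Z W
    assume *: "Y \<in> ?F" "Z \<in> ?F" "W \<in> carrier (D\<lparr>carrier := carrier D - {\<bottom>\<^bsub>D\<^esub>}\<rparr>)"
      "W \<sqsubseteq>\<^bsub>D\<lparr>carrier := carrier D - {\<bottom>\<^bsub>D\<^esub>}\<rparr>\<^esub> Y" "W \<sqsubseteq>\<^bsub>D\<lparr>carrier := carrier D - {\<bottom>\<^bsub>D\<^esub>}\<rparr>\<^esub> Z"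
    obtain y where y: "Y = {y}" "y \<in> X"
      using *(1) by (rule imageE)
    obtain z where z: "Z = {z}" "z \<in> X"
      using *(2) by (rule imageE)
    have W: "totally_mail_disconnected P W" "W \<noteq> {}"
      using *(3) by (simp_all add: D_bottom)
    then obtain w where w: "w \<in> W" "w \<in> carrier P"
      using totally_mail_disconnected_subset by fastforce
    then have "w \<sqsubseteq> y" "w \<sqsubseteq> z"
      using *(4,5) y z by simp_all
    then show "Y = Z"
      using totally_mail_disconnectedD[OF XD y(2) z(2) w(2)] y z by simp
  qed
  moreover have "X \<sqsubseteq>\<^bsub>D\<^esub> \<Squnion>\<^bsub>D\<^esub>?F"
    using XD D_sup_eq_Union[of ?F] D.le_refl[of X] unfolding U by simp
  \<comment> \<open>Some singleton \<open>{c}\<close> of the family lies above \<open>X\<close>, so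
    \<open>c\<close> is the largest element of \<open>X\<close>. For empty \<open>X\<close> the
    family would be empty, so this case is excluded as well.\<close>
  ultimately obtain c where c: "c \<in> X" "\<forall>x\<in>X. x \<sqsubseteq> c"
    using X unfolding absolutely_connected_def by auto
  then have "x = c" if "x \<in> X" for x
    using that totally_mail_disconnectedD[OF XD that c(1), of x] Xc by blast
  then show "X \<in> (\<lambda>c. {c}) ` carrier P"
    using c(1) Xc by blast
next
  fix X assume "X \<in> (\<lambda>c. {c}) ` carrier P"
  then obtain c where c: "X = {c}" "c \<in> carrier P" by blast
  let ?D = "D\<lparr>carrier := carrier D - {\<bottom>\<^bsub>D\<^esub>}\<rparr>"
  show "X \<in> absolutely_connected D"
    unfolding absolutely_connected_def
  proof (intro CollectI conjI allI impI)
    show "X \<in> carrier D" using c by (simp add: singleton_in_D)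
    fix F assume F: "totally_mail_disconnected ?D F" and le: "X \<sqsubseteq>\<^bsub>D\<^esub> \<Squnion>\<^bsub>D\<^esub>F"
    have FD: "totally_mail_disconnected P S" if "S \<in> F" for S
      using totally_mail_disconnected_subset[OF F] that by auto
    have "totally_mail_disconnected P (\<Union>F)"
    proof (rule totally_mail_disconnectedI)
      show "\<Union>F \<subseteq> carrier P"
        using FD totally_mail_disconnected_subset by blast
      fix x y z
      assume "x \<in> \<Union>F" "y \<in> \<Union>F" and z: "z \<in> carrier P" "z \<sqsubseteq> x" "z \<sqsubseteq> y"
      then obtain S T where ST: "S \<in> F" "T \<in> F" "x \<in> S" "y \<in> T" by blast
      \<comment> \<open>The nonempty set \<open>{z}\<close> is a common lower bound of
        \<open>S\<close> and \<open>T\<close> among the non-bottom elements, which forces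
        \<open>S = T\<close>.\<close>
      have "{z} \<in> carrier ?D" "{z} \<sqsubseteq>\<^bsub>?D\<^esub> S" "{z} \<sqsubseteq>\<^bsub>?D\<^esub> T"
        using z ST by (auto simp: singleton_in_D D_bottom)
      then have "S = T"
        using totally_mail_disconnectedD[OF F] ST by blast
      then show "x = y"
        using totally_mail_disconnectedD[OF FD] ST z by blast
    qed
    then show "\<exists>S\<in>F. X \<sqsubseteq>\<^bsub>D\<^esub> S"
      using le c by (auto simp: D_sup_eq_Union)
  qed
qed

lemma absolutely_connected_poset_D_isomorphic:
  "poset_isomorphic (absolutely_connected_poset D) P"
proof -
  have "bij_betw (\<lambda>c. {c}) (carrier P) (absolutely_connected D)"
    by (auto simp: bij_betw_def absolutely_connected_D)
  moreover have "weak_partial_order (absolutely_connected_poset D)"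
    unfolding absolutely_connected_poset_def
    by (rule weak_partial_order_subset[OF D.weak_partial_order_axioms absolutely_connected_subset_carrier])
  ultimately have "order_iso P (absolutely_connected_poset D) (\<lambda>c. {c})"
    using weak_partial_order_axioms
    by (simp add: order_iso_def order_emb_def absolutely_connected_poset_def)
  then show ?thesis
    using order_iso_inv by (auto simp: poset_isomorphic_def)
qed

section \<open>The connectivity adjunction on the lattice of disconnected sets\<close>

text \<open>By \<open>the_elem\<close>, a connected family of singletons becomes a connected subset
  of \<open>P\<close> with some join \<open>j\<close>. An upper bound \<open>V\<close> of the family
  has a single element above the whole subset by \<open>mail_connected_below_unique\<close>, so
  \<open>{j}\<close> is below \<open>V\<close> and is the join in \<open>D\<close>.\<close>

lemma subchainmail_D: "subchainmail D (absolutely_connected D)"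
  unfolding subchainmail_def
proof (intro conjI allI impI)
  show "absolutely_connected D \<subseteq> carrier D"
    by (rule absolutely_connected_subset_carrier)
  fix F assume F: "mail_connected (D\<lparr>carrier := absolutely_connected D\<rparr>) F"
  have sing: "F \<subseteq> (\<lambda>c. {c}) ` carrier P"
    using mail_connected_subset[OF F] by (simp add: absolutely_connected_D)
  have FD: "F \<subseteq> carrier D"
    using sing by (auto simp: singleton_in_D)
  \<comment> \<open>Lower bounds are taken among the absolutely connected elements, so they are
    singletons too and descend to elements of \<open>P\<close>.\<close>
  have mail: "mail P {the_elem X, the_elem Y}" if "mail (D\<lparr>carrier := absolutely_connected D\<rparr>) {X, Y}" for X Y
    using that unfolding mail_pair_iff by (auto simp: absolutely_connected_D)
  have conn: "mail_connected P (the_elem ` F)"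
    unfolding mail_connected_def
  proof (intro conjI ballI)
    show "the_elem ` F \<subseteq> carrier P" using sing by auto
    show "the_elem ` F \<noteq> {}" using F by (simp add: mail_connected_def)
    fix x y assume "x \<in> the_elem ` F" "y \<in> the_elem ` F"
    then obtain X Y where XY: "X \<in> F" "Y \<in> F" "x = the_elem X" "y = the_elem Y" by blast
    obtain s where s: "s \<noteq> []" "set s \<subseteq> F" "hd s = X" "last s = Y"
      "successively (\<lambda>a b. mail (D\<lparr>carrier := absolutely_connected D\<rparr>) {a, b}) s"
      using mail_connectedE[OF F XY(1,2)] .
    have "successively (\<lambda>a b. mail P {a, b}) (map the_elem s)"
      unfolding successively_map by (rule successively_mono[OF s(5)]) (rule mail)
    then show "\<exists>s. s \<noteq> [] \<and> set s \<subseteq> the_elem ` F \<and> hd s = x \<and> last s = y \<and>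
        successively (\<lambda>a b. mail P {a, b}) s"
      using s XY by (intro exI[of _ "map the_elem s"]) (auto simp: hd_map last_map)
  qed
  then obtain j where j: "is_lub P j (the_elem ` F)"
    using mail_connected_lub by blast
  then have jc: "j \<in> carrier P" and up: "\<And>x. x \<in> the_elem ` F \<Longrightarrow> x \<sqsubseteq> j"
    and least: "\<And>v. v \<in> carrier P \<Longrightarrow> \<forall>x\<in>the_elem ` F. x \<sqsubseteq> v \<Longrightarrow> j \<sqsubseteq> v"
    using is_lub_iff[OF mail_connected_subset[OF conn], of j] by auto
  have "is_lub D {j} F"
    unfolding is_lub_iff[OF FD]
  proof (intro conjI ballI impI)
    show "{j} \<in> carrier D" using jc by (simp add: singleton_in_D)
    show "X \<sqsubseteq>\<^bsub>D\<^esub> {j}" if "X \<in> F" for X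
      using that sing up by force
    fix V assume V: "V \<in> carrier D" "\<forall>X\<in>F. X \<sqsubseteq>\<^bsub>D\<^esub> V"
    have below: "\<forall>x\<in>the_elem ` F. \<exists>v\<in>V. x \<sqsubseteq> v"
      using V(2) sing by fastforce
    have TV: "totally_mail_disconnected P V"
      using V(1) by simp
    obtain v where v: "v \<in> V" "\<forall>x\<in>the_elem ` F. x \<sqsubseteq> v"
      using mail_connected_below_unique[OF TV conn below] .
    then have "j \<sqsubseteq> v"
      using least[of v] subsetD[OF totally_mail_disconnected_subset[OF TV] v(1)] by auto
    then show "{j} \<sqsubseteq>\<^bsub>D\<^esub> V"
      using v by auto
  qed
  then have "\<Squnion>\<^bsub>D\<^esub>F = {j}"
    using D.is_lub_iff_eq_sup[OF FD] by simp
  then show "\<Squnion>\<^bsub>D\<^esub>F \<in> absolutely_connected D"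
    using jc by (simp add: absolutely_connected_D)
qed

text \<open>Each \<open>{d}\<close> below \<open>S\<close> lies below some \<open>{s}\<close> with
  \<open>s\<close> in \<open>S\<close>, so only these can be maximal. They are indeed maximal
  because distinct elements of \<open>S\<close> are incomparable.\<close>

lemma components_D:
  assumes S: "totally_mail_disconnected P S"
  shows "components D (absolutely_connected D) S = (\<lambda>c. {c}) ` S"
proof -
  note Sc = totally_mail_disconnected_subset[OF S]
  have below: "{c} \<sqsubseteq>\<^bsub>D\<^esub> S" if "c \<in> S" for c
    using that le_refl[OF subsetD[OF Sc that]] by (simp add: bexI[of _ c])
  show ?thesis
  proof (intro equalityI subsetI)
    fix X assume X: "X \<in> components D (absolutely_connected D) S"
    then have "X \<in> (\<lambda>c. {c}) ` carrier P"
      by (simp add: components_def absolutely_connected_D)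
    then obtain c where c: "X = {c}" "c \<in> carrier P"
      by (rule imageE)
    have "\<exists>s\<in>S. c \<sqsubseteq> s"
      using X by (simp add: components_def c(1))
    then obtain s where s: "s \<in> S" "c \<sqsubseteq> s" ..
    have "{s} \<in> absolutely_connected D"
      using s(1) Sc by (auto simp: absolutely_connected_D)
    then have "{s} = X"
      using X below[OF s(1)] s(2) c(1) unfolding components_def by simp
    then show "X \<in> (\<lambda>c. {c}) ` S"
      using s(1) by (simp add: image_iff bexI[of _ s])
  next
    fix X assume "X \<in> (\<lambda>c. {c}) ` S"
    then obtain c where c: "X = {c}" "c \<in> S"
      by (rule imageE)
    have cc: "c \<in> carrier P"
      using Sc c(2) by (rule subsetD)
    show "X \<in> components D (absolutely_connected D) S"
      unfolding components_def
    proof (intro CollectI conjI ballI impI)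
      show "X \<in> absolutely_connected D"
        using cc c(1) by (simp add: absolutely_connected_D)
      show "X \<sqsubseteq>\<^bsub>D\<^esub> S"
        using below c by simp
      fix Y assume Y: "Y \<in> absolutely_connected D" "Y \<sqsubseteq>\<^bsub>D\<^esub> S" "X \<sqsubseteq>\<^bsub>D\<^esub> Y"
      from Y(1) obtain d where d: "Y = {d}" "d \<in> carrier P"
        unfolding absolutely_connected_D by (rule imageE)
      have "\<exists>s\<in>S. d \<sqsubseteq> s"
        using Y(2) d(1) by simp
      then obtain s where s: "s \<in> S" "d \<sqsubseteq> s" ..
      have cd: "c \<sqsubseteq> d"
        using Y(3) c(1) d(1) by simp
      have "s \<in> carrier P"
        using Sc s(1) by (rule subsetD)
      then have "c \<sqsubseteq> s"
        using le_trans[OF cd s(2) cc d(2)] by simp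
      then have "c = s"
        using totally_mail_disconnectedD[OF S c(2) s(1) cc] cc by simp
      then show "Y = X"
        using le_antisym[OF cd _ cc d(2)] s(2) c(1) d(1) by simp
    qed
  qed
qed

text \<open>The singletons form a copy of \<open>P\<close> inside \<open>D\<close>, and
  \<open>F\<close> is the copy of its own union. Hence joins of such families are plain
  unions.\<close>

lemma disconnected_singletons_iff:
  "totally_mail_disconnected (D\<lparr>carrier := absolutely_connected D\<rparr>) F \<longleftrightarrow>
    F \<subseteq> (\<lambda>c. {c}) ` carrier P \<and> totally_mail_disconnected P (\<Union>F)"
proof (cases "F \<subseteq> (\<lambda>c. {c}) ` carrier P")
  case False
  then show ?thesis
    using totally_mail_disconnected_subset[of "D\<lparr>carrier := absolutely_connected D\<rparr>" F]
    by (auto simp: absolutely_connected_D)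
next
  case True
  then obtain S where S: "S \<subseteq> carrier P" "F = (\<lambda>c. {c}) ` S"
    unfolding subset_image_iff by (elim exE conjE)
  have "\<Union>F = S"
    by (simp add: S(2))
  moreover have "totally_mail_disconnected (D\<lparr>carrier := absolutely_connected D\<rparr>) F \<longleftrightarrow>
      totally_mail_disconnected P S"
    using S True by (simp add: totally_mail_disconnected_iff absolutely_connected_D subset_iff)
  ultimately show ?thesis
    using True by simp
qed

text \<open>The preceding lemmas turn the two adjoints into taking the union of a set of singletons
  and splitting a set into singletons, which are visibly inverse to each other.\<close>

lemma absolute_connectivity_lattice_D:
  "absolute_connectivity_lattice D (absolutely_connected D)"
proof -
  let ?C = "D\<lparr>carrier := absolutely_connected D\<rparr>"
  have po: "partial_order (disconnected_sets ?C)"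
    by (intro partial_order_disconnected_sets partial_order_subset D.partial_order_axioms
        absolutely_connected_subset_carrier)
  then have wpo: "weak_partial_order (disconnected_sets ?C)"
    by (rule partial_order.axioms)
  have sup: "\<Squnion>\<^bsub>D\<^esub>F = \<Union>F" if "totally_mail_disconnected ?C F" for F
    using that D_sup_eq_Union by (simp add: disconnected_singletons_iff)
  have "galois_bijection (connectivity_adjunction D (absolutely_connected D))"
    unfolding galois_bijection_def galois_bijection_axioms_def connection_def
      connectivity_adjunction_def galcon.simps
  proof (intro conjI allI impI po D.partial_order_axioms)
    show "(\<lambda>F. \<Squnion>\<^bsub>D\<^esub>F) \<in> carrier (disconnected_sets ?C) \<rightarrow> carrier D"
      by (auto simp: sup disconnected_singletons_iff)
    show "components D (absolutely_connected D) \<in> carrier D \<rightarrow> carrier (disconnected_sets ?C)"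
      by (simp add: components_D disconnected_singletons_iff image_mono totally_mail_disconnected_subset)
    show "isotone (disconnected_sets ?C) D (\<lambda>F. \<Squnion>\<^bsub>D\<^esub>F)"
    proof (rule isotoneI[OF wpo D.weak_partial_order_axioms])
      fix F G
      assume *: "F \<in> carrier (disconnected_sets ?C)" "G \<in> carrier (disconnected_sets ?C)"
        "F \<sqsubseteq>\<^bsub>disconnected_sets ?C\<^esub> G"
      then have "\<Union>F \<sqsubseteq>\<^bsub>D\<^esub> \<Union>G"
        by simp blast
      then show "\<Squnion>\<^bsub>D\<^esub>F \<sqsubseteq>\<^bsub>D\<^esub> \<Squnion>\<^bsub>D\<^esub>G"
        using * sup by (metis disconnected_sets_simps(1) mem_Collect_eq)
    qed
    show "isotone D (disconnected_sets ?C) (components D (absolutely_connected D))"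
      by (rule isotoneI[OF D.weak_partial_order_axioms wpo]) (simp add: components_D)
    show "components D (absolutely_connected D) (\<Squnion>\<^bsub>D\<^esub>F) = F"
      if "F \<in> carrier (disconnected_sets ?C)" for F
    proof -
      have "F \<subseteq> (\<lambda>c. {c}) ` carrier P" and U: "totally_mail_disconnected P (\<Union>F)"
        using that by (simp_all add: disconnected_singletons_iff)
      from this(1) obtain S where "F = (\<lambda>c. {c}) ` S"
        unfolding subset_image_iff by (elim exE conjE)
      then have "(\<lambda>c. {c}) ` \<Union>F = F" by simp
      then show ?thesis
        using that U by (simp add: sup components_D)
    qed
    show "\<Squnion>\<^bsub>D\<^esub>(components D (absolutely_connected D) S) = S" if "S \<in> carrier D" for S
      using that by (simp add: components_D D_sup_eq_Union)
  qed
  then show ?thesis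
    by (simp add: absolute_connectivity_lattice_def connectivity_lattice_def subchainmail_D
        D.complete_lattice_axioms)
qed

end

section \<open>Absolute connectivity lattices\<close>

text \<open>A join computed in \<open>L\<close> that happens to lie in \<open>C\<close> is also the
  join in the induced order on \<open>C\<close>.\<close>

lemma subchainmail_imp_chainmail:
  assumes L: "complete_lattice L" and C: "subchainmail L C"
  shows "chainmail (L\<lparr>carrier := C\<rparr>)"
  unfolding chainmail_def
proof (intro conjI allI impI)
  interpret L: complete_lattice L by fact
  have CL: "C \<subseteq> carrier L"
    using C by (simp add: subchainmail_def)
  show "partial_order (L\<lparr>carrier := C\<rparr>)"
    by (rule partial_order_subset[OF L.partial_order_axioms CL])
  fix M assume M: "mail_connected (L\<lparr>carrier := C\<rparr>) M"
  have MC: "M \<subseteq> C"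
    using mail_connected_subset[OF M] by simp
  then have sub: "M \<subseteq> carrier L"
    using CL by (rule subset_trans)
  have "\<Squnion>\<^bsub>L\<^esub>M \<in> C"
    using C M by (simp add: subchainmail_def)
  moreover have "\<And>x. x \<in> M \<Longrightarrow> x \<sqsubseteq>\<^bsub>L\<^esub> \<Squnion>\<^bsub>L\<^esub>M"
    "\<And>v. v \<in> carrier L \<Longrightarrow> \<forall>x\<in>M. x \<sqsubseteq>\<^bsub>L\<^esub> v \<Longrightarrow> \<Squnion>\<^bsub>L\<^esub>M \<sqsubseteq>\<^bsub>L\<^esub> v"
    using L.sup_lub[OF sub] unfolding is_lub_iff[OF sub] by simp_all
  ultimately have "is_lub (L\<lparr>carrier := C\<rparr>) (\<Squnion>\<^bsub>L\<^esub>M) M"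
    using MC CL by (subst is_lub_iff) (simp_all add: subset_iff)
  then show "\<exists>j. is_lub (L\<lparr>carrier := C\<rparr>) j M" ..
qed

text \<open>Order reflection comes from the adjunction: \<open>lower G x\<close> is below
  \<open>lower G y\<close> iff \<open>x\<close> is below \<open>upper G (lower G y)\<close>, which
  is \<open>y\<close>.\<close>

lemma galois_bijection_order_iso:
  assumes "galois_bijection G"
  shows "order_iso (orderA G) (orderB G) (lower G)"
proof -
  interpret galois_bijection G by fact
  have "lower G x \<sqsubseteq>\<^bsub>orderB G\<^esub> lower G y \<longleftrightarrow> x \<sqsubseteq>\<^bsub>orderA G\<^esub> y"
    if "x \<in> carrier (orderA G)" "y \<in> carrier (orderA G)" for x y
    using that by (simp add: gal_bij_conn.galois_property lower_closed lower_inv_eq)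
  then show ?thesis
    using lower_bij gal_bij_conn.is_weak_order_A gal_bij_conn.is_weak_order_B
    by (simp add: order_iso_def order_emb_def)
qed

locale absolute_cl =
  fixes L :: "'a gorder" and C :: "'a set"
  assumes absolute: "absolute_connectivity_lattice L C"
begin

lemma
  shows subchainmail: "subchainmail L C" and lattice: "complete_lattice L"
  using absolute by (simp_all add: absolute_connectivity_lattice_def connectivity_lattice_def)

lemma chainmail_C: "chainmail (L\<lparr>carrier := C\<rparr>)"
  by (rule subchainmail_imp_chainmail[OF lattice subchainmail])

lemma order_iso_sup: "order_iso (disconnected_sets (L\<lparr>carrier := C\<rparr>)) L (\<lambda>F. \<Squnion>\<^bsub>L\<^esub>F)"
  using galois_bijection_order_iso[of "connectivity_adjunction L C"] absolute
  by (simp add: absolute_connectivity_lattice_def connectivity_adjunction_def)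

lemma sup_image_absolutely_connected:
  "(\<lambda>F. \<Squnion>\<^bsub>L\<^esub>F) ` absolutely_connected (disconnected_sets (L\<lparr>carrier := C\<rparr>)) = C"
proof -
  interpret C: chainmail_order "L\<lparr>carrier := C\<rparr>"
    using chainmail_C by (simp add: chainmail_iff)
  interpret L: complete_lattice L by (rule lattice)
  have "C \<subseteq> carrier L"
    using subchainmail by (simp add: subchainmail_def)
  then have "\<Squnion>\<^bsub>L\<^esub>{c} = c" if "c \<in> C" for c
    using that by auto
  then show ?thesis
    by (simp add: C.absolutely_connected_D image_image)
qed

text \<open>The join map is an isomorphism onto \<open>L\<close>, and it sends the absolutely
  connected \<open>{c}\<close> to \<open>c\<close>. Thus \<open>C\<close> can be recovered from the
  order of \<open>L\<close> alone.\<close>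

lemma absolutely_connected_eq: "absolutely_connected L = C"
proof -
  interpret C: chainmail_order "L\<lparr>carrier := C\<rparr>"
    using chainmail_C by (simp add: chainmail_iff)
  show ?thesis
    using order_iso_absolutely_connected[OF order_iso_sup C.D.complete_lattice_axioms lattice]
    by (simp add: sup_image_absolutely_connected)
qed

lemma absolutely_connected_poset_eq: "absolutely_connected_poset L = L\<lparr>carrier := C\<rparr>"
  by (simp add: absolutely_connected_poset_def absolutely_connected_eq)

lemma cl_isomorphic_D:
  "cl_isomorphic (disconnected_sets (L\<lparr>carrier := C\<rparr>))
     (absolutely_connected (disconnected_sets (L\<lparr>carrier := C\<rparr>))) L C"
  using order_iso_sup sup_image_absolutely_connected by (auto simp: cl_isomorphic_def)

end

section \<open>Both constructions respect and reflect isomorphism\<close>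

lemma cl_isomorphic_disconnected_sets:
  assumes "chainmail P" "chainmail Q" "poset_isomorphic P Q"
  shows "cl_isomorphic (disconnected_sets P) (absolutely_connected (disconnected_sets P))
    (disconnected_sets Q) (absolutely_connected (disconnected_sets Q))"
proof -
  interpret P: chainmail_order P
    using assms(1) by (simp add: chainmail_iff)
  interpret Q: chainmail_order Q
    using assms(2) by (simp add: chainmail_iff)
  obtain f where "order_iso P Q f"
    using assms(3) by (auto simp: poset_isomorphic_def)
  then have f: "order_iso (disconnected_sets P) (disconnected_sets Q) ((`) f)"
    by (rule order_iso_disconnected_sets) (rule P.partial_order_axioms Q.partial_order_axioms)+
  show ?thesis
    using f order_iso_absolutely_connected[OF f P.D.complete_lattice_axioms Q.D.complete_lattice_axioms]
    by (auto simp: cl_isomorphic_def)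
qed

text \<open>From left to right the isomorphism is restricted to \<open>C\<close>. Conversely, an
  isomorphism between \<open>C\<close> and \<open>C'\<close> lifts to their lattices of disconnected
  sets, and \<open>cl_isomorphic_D\<close> identifies these with \<open>L\<close> and
  \<open>L'\<close>.\<close>

lemma cl_isomorphic_iff:
  assumes "absolute_connectivity_lattice L C" "absolute_connectivity_lattice L' C'"
  shows "cl_isomorphic L C L' C' \<longleftrightarrow>
    poset_isomorphic (absolutely_connected_poset L) (absolutely_connected_poset L')"
proof -
  interpret A: absolute_cl L C by unfold_locales fact
  interpret B: absolute_cl L' C' by unfold_locales fact
  show ?thesis
    unfolding A.absolutely_connected_poset_eq B.absolutely_connected_poset_eq
  proof
    assume "cl_isomorphic L C L' C'"
    then show "poset_isomorphic (L\<lparr>carrier := C\<rparr>) (L'\<lparr>carrier := C'\<rparr>)"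
      using A.subchainmail by (intro cl_isomorphic_imp_poset_isomorphic) (auto simp: subchainmail_def)
  next
    assume "poset_isomorphic (L\<lparr>carrier := C\<rparr>) (L'\<lparr>carrier := C'\<rparr>)"
    note D = cl_isomorphic_disconnected_sets[OF A.chainmail_C B.chainmail_C this]
    show "cl_isomorphic L C L' C'"
      by (rule cl_isomorphic_trans[OF cl_isomorphic_trans[OF cl_isomorphic_sym[OF
              A.cl_isomorphic_D absolutely_connected_subset_carrier] D] B.cl_isomorphic_D])
  qed
qed

text \<open>For the converse, \<open>cl_isomorphic_iff\<close> passes to the absolutely connected
  elements, which give back both chainmails up to isomorphism.\<close>

lemma poset_isomorphic_iff:
  assumes "chainmail \<Gamma>" "chainmail \<Gamma>'"
  shows "poset_isomorphic \<Gamma> \<Gamma>' \<longleftrightarrow>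
    cl_isomorphic (disconnected_sets \<Gamma>) (absolutely_connected (disconnected_sets \<Gamma>))
      (disconnected_sets \<Gamma>') (absolutely_connected (disconnected_sets \<Gamma>'))"
proof
  interpret G: chainmail_order \<Gamma>
    using assms(1) by (simp add: chainmail_iff)
  interpret G': chainmail_order \<Gamma>'
    using assms(2) by (simp add: chainmail_iff)
  show "poset_isomorphic \<Gamma> \<Gamma>'"
    if iso: "cl_isomorphic (disconnected_sets \<Gamma>) (absolutely_connected (disconnected_sets \<Gamma>))
      (disconnected_sets \<Gamma>') (absolutely_connected (disconnected_sets \<Gamma>'))"
  proof -
    have "poset_isomorphic (absolutely_connected_poset (disconnected_sets \<Gamma>))
        (absolutely_connected_poset (disconnected_sets \<Gamma>'))"
      using iso cl_isomorphic_iff[OF G.absolute_connectivity_lattice_D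
          G'.absolute_connectivity_lattice_D] by simp
    then show ?thesis
      by (rule poset_isomorphic_trans[OF poset_isomorphic_trans[OF poset_isomorphic_sym[OF
              G.absolutely_connected_poset_D_isomorphic]]
            G'.absolutely_connected_poset_D_isomorphic])
  qed
qed (rule cl_isomorphic_disconnected_sets[OF assms])

text \<open>The correspondence is expressed without forming classes: the first two conjuncts say
  that the maps land in the right place, the two equivalences that they are well defined and
  injective on classes, the last two that they are mutually inverse. Separate type variables allow
  isomorphisms between structures over different types.\<close>

theorem corollary57:
  shows "(\<forall>(L :: 'a gorder) C. absolute_connectivity_lattice L C \<longrightarrow>
            chainmail (absolutely_connected_poset L))
    \<and> (\<forall>(\<Gamma> :: 'c gorder). chainmail \<Gamma> \<longrightarrow>
            absolute_connectivity_lattice (disconnected_sets \<Gamma>)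
              (absolutely_connected (disconnected_sets \<Gamma>)))
    \<and> (\<forall>(L :: 'a gorder) C (L' :: 'b gorder) C'.
            absolute_connectivity_lattice L C \<longrightarrow> absolute_connectivity_lattice L' C' \<longrightarrow>
            (cl_isomorphic L C L' C' \<longleftrightarrow>
             poset_isomorphic (absolutely_connected_poset L) (absolutely_connected_poset L')))
    \<and> (\<forall>(\<Gamma> :: 'c gorder) (\<Gamma>' :: 'd gorder). chainmail \<Gamma> \<longrightarrow> chainmail \<Gamma>' \<longrightarrow>
            (poset_isomorphic \<Gamma> \<Gamma>' \<longleftrightarrow>
             cl_isomorphic
               (disconnected_sets \<Gamma>) (absolutely_connected (disconnected_sets \<Gamma>))
               (disconnected_sets \<Gamma>') (absolutely_connected (disconnected_sets \<Gamma>'))))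
    \<and> (\<forall>(L :: 'a gorder) C. absolute_connectivity_lattice L C \<longrightarrow>
            cl_isomorphic
              (disconnected_sets (absolutely_connected_poset L))
              (absolutely_connected (disconnected_sets (absolutely_connected_poset L)))
              L C)
    \<and> (\<forall>(\<Gamma> :: 'c gorder). chainmail \<Gamma> \<longrightarrow>
            poset_isomorphic (absolutely_connected_poset (disconnected_sets \<Gamma>)) \<Gamma>)"
proof (intro conjI allI impI)
  show "chainmail (absolutely_connected_poset L)"
    if "absolute_connectivity_lattice L C" for L :: "'a gorder" and C
  proof -
    interpret absolute_cl L C by unfold_locales fact
    show ?thesis
      using chainmail_C by (simp add: absolutely_connected_poset_eq)
  qed
  show "absolute_connectivity_lattice (disconnected_sets \<Gamma>)
      (absolutely_connected (disconnected_sets \<Gamma>))"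
    if "chainmail \<Gamma>" for \<Gamma> :: "'c gorder"
    using that chainmail_order.absolute_connectivity_lattice_D by (auto simp: chainmail_iff)
  show "cl_isomorphic L C L' C' \<longleftrightarrow>
      poset_isomorphic (absolutely_connected_poset L) (absolutely_connected_poset L')"
    if "absolute_connectivity_lattice L C" "absolute_connectivity_lattice L' C'"
    for L :: "'a gorder" and C and L' :: "'b gorder" and C'
    by (rule cl_isomorphic_iff) fact+
  show "poset_isomorphic \<Gamma> \<Gamma>' \<longleftrightarrow>
      cl_isomorphic (disconnected_sets \<Gamma>) (absolutely_connected (disconnected_sets \<Gamma>))
        (disconnected_sets \<Gamma>') (absolutely_connected (disconnected_sets \<Gamma>'))"
    if "chainmail \<Gamma>" "chainmail \<Gamma>'" for \<Gamma> :: "'c gorder" and \<Gamma>' :: "'d gorder"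
    by (rule poset_isomorphic_iff) fact+
  show "cl_isomorphic (disconnected_sets (absolutely_connected_poset L))
      (absolutely_connected (disconnected_sets (absolutely_connected_poset L))) L C"
    if "absolute_connectivity_lattice L C" for L :: "'a gorder" and C
  proof -
    interpret absolute_cl L C by unfold_locales fact
    show ?thesis
      using cl_isomorphic_D by (simp add: absolutely_connected_poset_eq)
  qed
  show "poset_isomorphic (absolutely_connected_poset (disconnected_sets \<Gamma>)) \<Gamma>"
    if "chainmail \<Gamma>" for \<Gamma> :: "'c gorder"
    using that chainmail_order.absolutely_connected_poset_D_isomorphic by (auto simp: chainmail_iff)
qed

end
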